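(* Let $M\in\mathbb N$, let $\Lambda\subset\mathbb Z^d$ be finite and nonempty, and let $u:\mathcal X\to\mathbb R$ be a function of $(\eta_x)_{x\in\Lambda^+}$ only. For $N\in\mathbb N$ and $y\in\Lambda^+$ put $$P_{\Lambda,M,N}=\tilde{\mathbb P}_{\Lambda^+,M}\Big[\sum_{z\in\Lambda^+\setminus\{y\}}\mathbf 1_{\{\tilde\eta_z>0\}}=N-1\Big],$$ which does not depend on the choice of $y\in\Lambda^+$. Then for every $i\in\{1,\dots,d\}$, $$\sum_{x\in\Lambda}\langle\!\langle\partial_i[u](\tilde\eta,x)\rangle\!\rangle_{\Lambda^+,M}=\sum_{N=1}^{M+1}\frac{|\Lambda^+|\,P_{\Lambda,M,N}}{2N}\sum_{x\in\Lambda}\langle\nabla_{x,e_i}u\rangle_{\Lambda^+,N},$$ where terms with $N>|\Lambda^+|$ (for which $P_{\Lambda,M,N}=0$) are understood as $0$.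
   Context: $\mathcal X=\{0,1\}^{\mathbb Z^d}$, $\tilde{\mathcal X}=\mathbb N^{\mathbb Z^d}$, $\mathbb N=\{0,1,2,\dots\}$, $e_1,\dots,e_d$ the canonical basis. $\Lambda^+=\Lambda\cup\bigcup_{i=1}^d(\Lambda+e_i)$. $\langle\cdot\rangle_{\Lambda^+,N}$ is the expectation under the uniform measure on configurations in $\{0,1\}^{\Lambda^+}$ with exactly $N$ particles. $\tilde{\mathbb P}_{\Lambda^+,M}$ (expectation $\langle\!\langle\cdot\rangle\!\rangle_{\Lambda^+,M}$) is the law of $(\tilde\eta_x)_{x\in\Lambda^+}\in\mathbb N^{\Lambda^+}$ obtained by placing $M$ particles independently and uniformly on $\Lambda^+$ ($\tilde\eta_x$ = number of particles at $x$). For $u:\mathcal X\to\mathbb R$, $[u](\tilde\eta)=u([\tilde\eta])$ with $[\tilde\eta]_x=\mathbf 1_{\{\tilde\eta_x\ge1\}}$, and $\partial_i[u](\tilde\eta,x)=[u](\tilde\eta+\delta_{x+e_i})-[u](\tilde\eta+\delta_x)$, where $\delta_x$ is one particle at $x$. $\nabla_{x,e_i}u(\eta)=(u(\eta^{x,x+e_i})-u(\eta))(\eta_x-\eta_{x+e_i})$, where $\eta^{x,y}$ is $\eta$ with values at $x,y$ exchanged. *)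

theory Defs
  imports "HOL-Probability.Probability"
begin

text \<open>The lattice \<open>\<int>\<^sup>d\<close> is \<open>int ^ 'd\<close> with \<open>e\<^sub>i = axis i 1\<close>; \<open>{0,1}\<close>-valued configurations are
  \<open>bool\<close>-valued functions, with \<open>of_bool\<close> giving the numerical value at a site.\<close>

type_synonym 'd site = "int ^ 'd"
type_synonym 'd conf = "'d site \<Rightarrow> bool"
type_synonym 'd nconf = "'d site \<Rightarrow> nat"

definition unit_vec :: "'d::finite \<Rightarrow> 'd site" where
  "unit_vec i = axis i 1"

definition enlarge :: "'d::finite site set \<Rightarrow> 'd site set" where
  "enlarge \<Lambda> = \<Lambda> \<union> (\<Union>i. (\<lambda>x. x + unit_vec i) ` \<Lambda>)"

definition depends_only_on :: "('d::finite conf \<Rightarrow> real) \<Rightarrow> 'd site set \<Rightarrow> bool" where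
  "depends_only_on u A \<longleftrightarrow> (\<forall>\<eta> \<xi>. (\<forall>x\<in>A. \<eta> x = \<xi> x) \<longrightarrow> u \<eta> = u \<xi>)"

text \<open>Elements of \<open>{0,1}\<^sup>A\<close> are represented as configurations on the whole lattice that are empty
  outside \<open>A\<close>. The set is nonempty, and the expectation below meaningful, only for \<open>N \<le> card A\<close>.\<close>

definition confs :: "'d::finite site set \<Rightarrow> nat \<Rightarrow> 'd conf set" where
  "confs A N = {\<eta> \<in> PiE_dflt A False (\<lambda>_. UNIV). card {x \<in> A. \<eta> x} = N}"

definition canonical_expect :: "'d::finite site set \<Rightarrow> nat \<Rightarrow> ('d conf \<Rightarrow> real) \<Rightarrow> real" where
  "canonical_expect A N f = measure_pmf.expectation (pmf_of_set (confs A N)) f"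

text \<open>In the next definition \<open>p k\<close> is the position of the particle with label \<open>k < M\<close>; as all
  positions lie in \<open>A\<close>, the resulting configuration vanishes outside \<open>A\<close>.\<close>

definition placement_pmf :: "'d::finite site set \<Rightarrow> nat \<Rightarrow> 'd nconf pmf" where
  "placement_pmf A M =
     map_pmf (\<lambda>p x. card {k \<in> {..<M}. p k = x})
       (Pi_pmf {..<M} undefined (\<lambda>_. pmf_of_set A))"

definition placement_expect :: "'d::finite site set \<Rightarrow> nat \<Rightarrow> ('d nconf \<Rightarrow> real) \<Rightarrow> real" where
  "placement_expect A M f = measure_pmf.expectation (placement_pmf A M) f"

text \<open>The equation is between integers, so that the event is empty for \<open>N = 0\<close>.\<close>

definition occupation_prob :: "'d::finite site set \<Rightarrow> nat \<Rightarrow> nat \<Rightarrow> 'd site \<Rightarrow> real" where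
  "occupation_prob A M N y =
     measure_pmf.prob (placement_pmf A M)
       {\<eta>. (\<Sum>z\<in>A - {y}. of_bool (\<eta> z > 0)) = int N - 1}"

definition truncate :: "'d::finite nconf \<Rightarrow> 'd conf" where
  "truncate \<eta> = (\<lambda>x. \<eta> x \<ge> 1)"

definition lift :: "('d::finite conf \<Rightarrow> real) \<Rightarrow> 'd nconf \<Rightarrow> real" where
  "lift u \<eta> = u (truncate \<eta>)"

definition add_particle :: "'d::finite nconf \<Rightarrow> 'd site \<Rightarrow> 'd nconf" where
  "add_particle \<eta> x = (\<lambda>z. \<eta> z + of_bool (z = x))"

definition particle_diff ::
    "'d::finite \<Rightarrow> ('d nconf \<Rightarrow> real) \<Rightarrow> 'd nconf \<Rightarrow> 'd site \<Rightarrow> real" where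
  "particle_diff i v \<eta> x = v (add_particle \<eta> (x + unit_vec i)) - v (add_particle \<eta> x)"

definition exchange :: "'d::finite conf \<Rightarrow> 'd site \<Rightarrow> 'd site \<Rightarrow> 'd conf" where
  "exchange \<eta> x y = \<eta>(x := \<eta> y, y := \<eta> x)"

definition exchange_grad ::
    "'d::finite site \<Rightarrow> 'd \<Rightarrow> ('d conf \<Rightarrow> real) \<Rightarrow> 'd conf \<Rightarrow> real" where
  "exchange_grad x i u \<eta> =
     (u (exchange \<eta> x (x + unit_vec i)) - u \<eta>)
       * (of_bool (\<eta> x) - of_bool (\<eta> (x + unit_vec i)))"

end

theory Submission
  imports Defs
begin

text \<open>Only the random set \<open>S\<close> of occupied sites matters. Composing a placement with a bijection
  between two sets of sites shows that \<open>\<P>(S = T) = w(|T|)\<close> for a function \<open>w\<close>. Splitting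
  \<open>insert y S = U\<close> according to \<open>S = U\<close> or \<open>S = U - {y}\<close> gives
  \<open>\<P>(insert y S = U) = 1\<^bsub>y \<in> U\<^esub> (w(|U|) + w(|U| - 1))\<close>. Hence \<open>insert y S\<close>, conditioned on having
  \<open>N\<close> elements, is uniform among the \<open>N\<close>-element sets containing \<open>y\<close>, and there are
  \<open>(N / |\<Lambda>\<^sup>+|) (|\<Lambda>\<^sup>+| choose N)\<close> of these. The left-hand side thus becomes a sum over canonical averages of
  \<open>u (\<eta>\<^bsub>x+e\<^esub> - \<eta>\<^bsub>x\<^esub>)\<close>, which is half the average of the exchange gradient, as the uniform
  measure is invariant under exchanges.\<close>

section \<open>Surjections and the law of the set of occupied sites\<close>

definition surjections :: "nat \<Rightarrow> 'a set \<Rightarrow> (nat \<Rightarrow> 'a) set" where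
  "surjections M T = {p \<in> {..<M} \<rightarrow>\<^sub>E T. p ` {..<M} = T}"

text \<open>Postcomposition with \<open>f\<close> and with its inverse are mutually inverse. The two
  sets may have different types, so any set of occupied sites can be compared with an initial
  segment of the naturals.\<close>

lemma card_surjections_cong:
  assumes "bij_betw f T T'"
  shows "card (surjections M T) = card (surjections M T')"
proof -
  let ?g = "inv_into T f"
  have f: "f ` T = T'" and inj: "inj_on f T"
    using assms by (auto simp: bij_betw_def)
  have gf: "?g (f x) = x" if "x \<in> T" for x
    using that inj by simp
  have fg: "f (?g x) = x" "?g x \<in> T" if "x \<in> T'" for x
    using that f by (auto simp: f_inv_into_f inv_into_into)
  have g: "?g ` T' = T"
    using f gf by force
  \<comment> \<open>The fresh types for \<open>R\<close> and \<open>h\<close> let this fact and the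
    next serve both for \<open>f\<close> and for its inverse, which run between different
    types.\<close>
  have map: "restrict (h \<circ> p) {..<M} \<in> surjections M (h ` R)"
    if "p \<in> surjections M R" for p and R :: "'c set" and h :: "'c \<Rightarrow> 'e"
    using that by (auto simp: surjections_def image_comp[symmetric])
  have inv: "restrict (k \<circ> restrict (h \<circ> p) {..<M}) {..<M} = p"
    if "p \<in> surjections M R" "\<And>x. x \<in> R \<Longrightarrow> k (h x) = x"
    for p and R :: "'c set" and h :: "'c \<Rightarrow> 'e" and k
    using that by (auto simp: surjections_def fun_eq_iff PiE_iff extensional_def)
  have "bij_betw (\<lambda>p. restrict (f \<circ> p) {..<M}) (surjections M T) (surjections M T')"
  proof (rule bij_betw_byWitness[where f' = "\<lambda>p. restrict (?g \<circ> p) {..<M}"])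
    show "\<forall>p\<in>surjections M T. restrict (?g \<circ> restrict (f \<circ> p) {..<M}) {..<M} = p"
      by (intro ballI inv) (auto intro: gf)
    show "\<forall>p\<in>surjections M T'. restrict (f \<circ> restrict (?g \<circ> p) {..<M}) {..<M} = p"
      by (intro ballI inv) (auto intro: fg)
    show "(\<lambda>p. restrict (f \<circ> p) {..<M}) ` surjections M T \<subseteq> surjections M T'"
      using map[of _ T f] unfolding f by blast
    show "(\<lambda>p. restrict (?g \<circ> p) {..<M}) ` surjections M T' \<subseteq> surjections M T"
      using map[of _ T' ?g] unfolding g by blast
  qed
  then show ?thesis
    by (rule bij_betw_same_card)
qed

lemma surjections_empty:
  assumes "M < card T"
  shows "surjections M T = {}"
proof -
  have "p ` {..<M} \<noteq> T" for p
    using assms card_image_le[of "{..<M}" p] by auto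
  then show ?thesis
    by (simp add: surjections_def)
qed

definition occupied_pmf :: "'a set \<Rightarrow> nat \<Rightarrow> 'a set pmf" where
  "occupied_pmf A M =
     map_pmf (\<lambda>p. p ` {..<M}) (Pi_pmf {..<M} undefined (\<lambda>_. pmf_of_set A))"

text \<open>This is the w of the overview, with \<open>{..<k}\<close> as the model of a k-element
  set of sites: numerator and denominator count the placements with image exactly that set and all
  placements.\<close>

definition occupation_weight :: "'a set \<Rightarrow> nat \<Rightarrow> nat \<Rightarrow> real" where
  "occupation_weight A M k = real (card (surjections M {..<k})) / real (card A ^ M)"

context
  fixes A :: "'a set" and M :: nat
  assumes A: "finite A" "A \<noteq> {}"
begin

lemma occupied_pmf_eq:
  "occupied_pmf A M = map_pmf (\<lambda>p. p ` {..<M}) (pmf_of_set ({..<M} \<rightarrow>\<^sub>E A))"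
proof -
  have "PiE_dflt {..<M} undefined (\<lambda>_. A) = {..<M} \<rightarrow>\<^sub>E A"
    by (auto simp: PiE_dflt_def PiE_iff extensional_def)
  then show ?thesis
    using A by (simp add: occupied_pmf_def Pi_pmf_of_set)
qed

lemma pmf_occupied:
  assumes "T \<subseteq> A"
  shows "pmf (occupied_pmf A M) T = occupation_weight A M (card T)"
proof -
  have ne: "{..<M} \<rightarrow>\<^sub>E A \<noteq> {}" and fin: "finite ({..<M} \<rightarrow>\<^sub>E A)"
    using A by (auto simp: PiE_eq_empty_iff intro: finite_PiE)
  have "finite T"
    using A assms finite_subset by blast
  then obtain f where "bij_betw f T {..<card T}"
    using ex_bij_betw_finite_nat by (metis atLeast0LessThan)
  \<comment> \<open>As \<open>T\<close> lies in \<open>A\<close>, a placement in \<open>A\<close>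
    with image \<open>T\<close> is the same thing as a surjection onto \<open>T\<close>.\<close>
  moreover have "({..<M} \<rightarrow>\<^sub>E A) \<inter> (\<lambda>p. p ` {..<M}) -` {T} = surjections M T"
    using assms by (auto simp: surjections_def PiE_iff extensional_def)
  ultimately show ?thesis
    using ne fin
    by (simp add: occupied_pmf_eq pmf_map measure_pmf_of_set occupation_weight_def card_PiE
        card_surjections_cong)
qed

lemma set_occupied: "set_pmf (occupied_pmf A M) \<subseteq> Pow A"
proof -
  have "{..<M} \<rightarrow>\<^sub>E A \<noteq> {}" and "finite ({..<M} \<rightarrow>\<^sub>E A)"
    using A by (auto simp: PiE_eq_empty_iff intro: finite_PiE)
  then show ?thesis
    by (auto simp: occupied_pmf_eq PiE_iff)
qed

text \<open>The site \<open>y\<close> enters the sum only through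
  \<open>of_bool (y \<in> U)\<close>. Hence the formulas for two sites have the same index set and
  the same weights, and can be subtracted term by term.\<close>

lemma expectation_insert:
  fixes v :: "'a set \<Rightarrow> real"
  assumes "y \<in> A"
  shows "measure_pmf.expectation (occupied_pmf A M) (\<lambda>S. v (insert y S)) =
    (\<Sum>U\<in>Pow A. (occupation_weight A M (card U - 1) + occupation_weight A M (card U))
      * of_bool (y \<in> U) * v U)"
proof -
  let ?w = "occupation_weight A M"
  let ?I = "insert y ` Pow (A - {y})"
  have split: "Pow A = Pow (A - {y}) \<union> ?I"
    using assms by (metis Pow_insert insert_Diff)
  have disj: "Pow (A - {y}) \<inter> ?I = {}"
    by auto
  have inj: "inj_on (insert y) (Pow (A - {y}))"
    by (auto simp: inj_on_def)
  have fin: "finite (Pow (A - {y}))"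
    using A by simp
  have card: "card (insert y R) = Suc (card R)" if "R \<in> Pow (A - {y})" for R
  proof -
    have "finite R" "y \<notin> R"
      using that A finite_subset by auto
    then show ?thesis by simp
  qed
  have "measure_pmf.expectation (occupied_pmf A M) (\<lambda>S. v (insert y S)) =
      (\<Sum>S\<in>Pow A. ?w (card S) * v (insert y S))"
    using A set_occupied by (subst integral_measure_pmf[of "Pow A"]) (auto simp: pmf_occupied)
  \<comment> \<open>The sets \<open>R\<close> and \<open>insert y R\<close> are paired: as values of
    S they give the same \<open>insert y S\<close>.\<close>
  also have "\<dots> = (\<Sum>R\<in>Pow (A - {y}). (?w (card R) + ?w (Suc (card R))) * v (insert y R))"
    unfolding split
    by (subst sum.union_disjoint)
      (use fin disj in \<open>auto simp: sum.reindex[OF inj] card sum.distrib distrib_right\<close>)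
  also have "\<dots> = (\<Sum>U\<in>?I. (?w (card U - 1) + ?w (card U)) * v U)"
    by (simp add: sum.reindex[OF inj] card)
  also have "\<dots> = (\<Sum>U\<in>Pow A. (?w (card U - 1) + ?w (card U)) * of_bool (y \<in> U) * v U)"
    by (rule sum.mono_neutral_cong_left) (use A split in auto)
  finally show ?thesis .
qed

text \<open>Deleting \<open>y\<close> is a bijection onto the subsets of \<open>A - {y}\<close> of
  size N - 1. Truncated subtraction forces N to be positive: for N = 0 the binomial coefficient
  would be 1, but no set qualifies.\<close>

lemma card_subsets_containing:
  assumes "y \<in> A" "1 \<le> N"
  shows "card {U. U \<subseteq> A \<and> card U = N \<and> y \<in> U} = (card A - 1) choose (N - 1)"
proof -
  have inj: "inj_on (insert y) {R. R \<subseteq> A - {y} \<and> card R = N - 1}"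
    by (auto simp: inj_on_def)
  have "{U. U \<subseteq> A \<and> card U = N \<and> y \<in> U} = insert y ` {R. R \<subseteq> A - {y} \<and> card R = N - 1}"
  proof (intro equalityI subsetI)
    fix U assume U: "U \<in> {U. U \<subseteq> A \<and> card U = N \<and> y \<in> U}"
    then have "U = insert y (U - {y})" "card (U - {y}) = N - 1"
      using A finite_subset by (auto simp: card_Diff_singleton)
    with U show "U \<in> insert y ` {R. R \<subseteq> A - {y} \<and> card R = N - 1}"
      by blast
  next
    fix U assume "U \<in> insert y ` {R. R \<subseteq> A - {y} \<and> card R = N - 1}"
    then obtain R where R: "U = insert y R" "R \<subseteq> A - {y}" "card R = N - 1"
      by blast
    then have "finite R" "y \<notin> R"
      using A finite_subset by auto
    then show "U \<in> {U. U \<subseteq> A \<and> card U = N \<and> y \<in> U}"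
      using R assms by auto
  qed
  then have "card {U. U \<subseteq> A \<and> card U = N \<and> y \<in> U} = card {R. R \<subseteq> A - {y} \<and> card R = N - 1}"
    by (simp only: card_image[OF inj])
  then show ?thesis
    using A assms by (simp add: n_subsets)
qed

lemma prob_card_insert:
  assumes "y \<in> A" "1 \<le> N"
  shows "measure_pmf.prob (occupied_pmf A M) {S. card (insert y S) = N} =
    real ((card A - 1) choose (N - 1))
      * (occupation_weight A M (N - 1) + occupation_weight A M N)"
proof -
  let ?w = "occupation_weight A M"
  have "measure_pmf.prob (occupied_pmf A M) {S. card (insert y S) = N} =
      measure_pmf.expectation (occupied_pmf A M) (\<lambda>S. of_bool (card (insert y S) = N))"
  proof -
    have "(\<lambda>S. of_bool (card (insert y S) = N) :: real) = indicator {S. card (insert y S) = N}"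
      by (auto simp: fun_eq_iff)
    then show ?thesis by simp
  qed
  also have "\<dots> = (\<Sum>U\<in>Pow A. (?w (card U - 1) + ?w (card U))
      * of_bool (y \<in> U) * of_bool (card U = N))"
    by (rule expectation_insert[OF assms(1)])
  also have "\<dots> = (\<Sum>U\<in>{U. U \<subseteq> A \<and> card U = N \<and> y \<in> U}. ?w (N - 1) + ?w N)"
    by (rule sum.mono_neutral_cong_right) (use A in auto)
  finally show ?thesis
    using assms by (simp add: card_subsets_containing)
qed

end

section \<open>Occupation probabilities and particle differences\<close>

lemma map_occupied_placement:
  "map_pmf (\<lambda>\<eta>. {z. \<eta> z > 0}) (placement_pmf A M) = occupied_pmf A M"
  unfolding placement_pmf_def occupied_pmf_def
  by (auto simp: map_pmf_comp card_gt_0_iff intro!: map_pmf_cong)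

text \<open>Whether or not \<open>y\<close> is occupied, adjoining it adds exactly one to the number
  of occupied sites other than \<open>y\<close>. The two events are compared on the support only,
  where all occupied sites lie in \<open>A\<close>.\<close>

lemma occupation_prob_eq_prob_insert:
  assumes A: "finite A" "A \<noteq> {}" and "y \<in> A"
  shows "occupation_prob A M N y =
    measure_pmf.prob (occupied_pmf A M) {S. card (insert y S) = N}"
proof -
  have "(\<Sum>z\<in>A - {y}. of_bool (\<eta> z > 0)) = int N - 1 \<longleftrightarrow> card (insert y {z. \<eta> z > 0}) = N"
    if \<eta>: "\<eta> \<in> set_pmf (placement_pmf A M)" for \<eta>
  proof -
    have "{z. \<eta> z > 0} \<in> set_pmf (occupied_pmf A M)"
      using \<eta> unfolding map_occupied_placement[symmetric] by auto
    then have sub: "{z. \<eta> z > 0} \<subseteq> A"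
      using set_occupied[OF A] by blast
    then have eq: "insert y {z. \<eta> z > 0} = insert y {z \<in> A - {y}. \<eta> z > 0}"
      by auto
    have "card (insert y {z. \<eta> z > 0}) = Suc (card {z \<in> A - {y}. \<eta> z > 0})"
      unfolding eq using A by simp
    moreover have "(\<Sum>z\<in>A - {y}. of_bool (\<eta> z > 0)) = int (card {z \<in> A - {y}. \<eta> z > 0})"
      using A by (simp add: of_bool_def sum.If_cases Int_def)
    ultimately show ?thesis by linarith
  qed
  then have "occupation_prob A M N y =
      measure_pmf.prob (placement_pmf A M) ((\<lambda>\<eta>. {z. \<eta> z > 0}) -` {S. card (insert y S) = N})"
    unfolding occupation_prob_def
    by (intro measure_pmf.finite_measure_eq_AE) (auto simp: AE_measure_pmf_iff)
  then show ?thesis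
    by (simp add: map_occupied_placement[symmetric])
qed

text \<open>Since \<open>y\<close> is absent from the right-hand side, the choice of
  \<open>y\<close> is immaterial. N = 0 is a separate case because with truncated subtraction the
  product would be 2 for M = 0, whereas the event is empty.\<close>

lemma occupation_prob_eq:
  assumes "finite A" "A \<noteq> {}" "y \<in> A"
  shows "occupation_prob A M N y =
    (if N = 0 then 0 else real ((card A - 1) choose (N - 1))
      * (occupation_weight A M (N - 1) + occupation_weight A M N))"
proof (cases "N = 0")
  case True
  have "(\<Sum>z\<in>A - {y}. of_bool (\<eta> z > 0)) \<noteq> (- 1 :: int)" for \<eta> :: "_ \<Rightarrow> nat"
    using sum_nonneg[of "A - {y}" "\<lambda>z. of_bool (\<eta> z > 0) :: int"] by auto
  then show ?thesis
    using True by (simp add: occupation_prob_def)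
next
  case False
  then show ?thesis
    using assms by (simp add: occupation_prob_eq_prob_insert prob_card_insert)
qed

lemma placement_expect_particle_diff:
  assumes A: "finite A" "A \<noteq> {}" and "x \<in> A" "x + unit_vec i \<in> A"
  shows "placement_expect A M (\<lambda>\<eta>. particle_diff i (lift u) \<eta> x) =
    (\<Sum>U\<in>Pow A. (occupation_weight A M (card U - 1) + occupation_weight A M (card U))
      * ((of_bool (x + unit_vec i \<in> U) - of_bool (x \<in> U)) * u (\<lambda>z. z \<in> U)))"
proof -
  let ?v = "\<lambda>U. u (\<lambda>z. z \<in> U)" and ?y = "x + unit_vec i"
  \<comment> \<open>After truncation, adding a particle at a site only marks that site as occupied,
    whatever was there before.\<close>
  have lift: "lift u (add_particle \<eta> z) = ?v (insert z {z. \<eta> z > 0})" for \<eta> z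
    unfolding lift_def truncate_def add_particle_def
    by (rule arg_cong[of _ _ u]) auto
  have int: "integrable (occupied_pmf A M) f" for f :: "_ \<Rightarrow> real"
    by (rule integrable_measure_pmf_finite) (use A set_occupied[OF A] finite_subset in blast)
  have "placement_expect A M (\<lambda>\<eta>. particle_diff i (lift u) \<eta> x) =
      measure_pmf.expectation (occupied_pmf A M) (\<lambda>S. ?v (insert ?y S) - ?v (insert x S))"
    by (simp add: placement_expect_def particle_diff_def lift map_occupied_placement[symmetric])
  also have "\<dots> = measure_pmf.expectation (occupied_pmf A M) (\<lambda>S. ?v (insert ?y S))
      - measure_pmf.expectation (occupied_pmf A M) (\<lambda>S. ?v (insert x S))"
    by (intro Bochner_Integration.integral_diff int)
  finally show ?thesis
    using assms expectation_insert[OF A, where y = ?y and v = ?v]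
      expectation_insert[OF A, where y = x and v = ?v]
    by (simp only: sum_subtractf[symmetric] right_diff_distrib left_diff_distrib mult.assoc)
qed

section \<open>Canonical averages and the exchange gradient\<close>

lemma confs_eq_image: "confs A N = (\<lambda>U z. z \<in> U) ` {U. U \<subseteq> A \<and> card U = N}"
proof (intro equalityI subsetI)
  fix \<eta> assume "\<eta> \<in> confs A N"
  then have "Collect \<eta> \<subseteq> A" "card {x \<in> A. \<eta> x} = N"
    by (auto simp: confs_def PiE_dflt_def)
  moreover from this have "{x \<in> A. \<eta> x} = Collect \<eta>"
    by blast
  ultimately have "Collect \<eta> \<in> {U. U \<subseteq> A \<and> card U = N}"
    by simp
  then show "\<eta> \<in> (\<lambda>U z. z \<in> U) ` {U. U \<subseteq> A \<and> card U = N}"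
    by (rule rev_image_eqI) simp
next
  fix \<eta> assume "\<eta> \<in> (\<lambda>U z. z \<in> U) ` {U. U \<subseteq> A \<and> card U = N}"
  then obtain U where \<eta>: "\<eta> = (\<lambda>z. z \<in> U)" and U: "U \<subseteq> A" "card U = N"
    by (elim imageE CollectE conjE)
  have "{z \<in> A. z \<in> U} = U"
    using U(1) by blast
  then show "\<eta> \<in> confs A N"
    using U by (auto simp: \<eta> confs_def PiE_dflt_def)
qed

lemma finite_confs: "finite A \<Longrightarrow> finite (confs A N)"
  by (simp add: confs_eq_image)

lemma sum_confs: "(\<Sum>\<eta>\<in>confs A N. f \<eta>) = (\<Sum>U | U \<subseteq> A \<and> card U = N. f (\<lambda>z. z \<in> U))"
  unfolding confs_eq_image by (subst sum.reindex) (auto simp: inj_on_def fun_eq_iff)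

lemma card_confs: "finite A \<Longrightarrow> card (confs A N) = card A choose N"
  unfolding confs_eq_image
  by (subst card_image) (auto simp: inj_on_def fun_eq_iff n_subsets)

lemma exchange_exchange: "exchange (exchange \<eta> x y) x y = \<eta>"
  by (auto simp: exchange_def fun_eq_iff)

lemma exchange_in_confs:
  assumes "finite A" "x \<in> A" "y \<in> A" "\<eta> \<in> confs A N"
  shows "exchange \<eta> x y \<in> confs A N"
proof -
  have "bij_betw (Transposition.transpose x y) {z \<in> A. exchange \<eta> x y z} {z \<in> A. \<eta> z}"
    by (rule bij_betw_byWitness[where f' = "Transposition.transpose x y"])
      (use assms in \<open>auto simp: exchange_def Transposition.transpose_def split: if_splits\<close>)
  then have "card {z \<in> A. exchange \<eta> x y z} = card {z \<in> A. \<eta> z}"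
    by (rule bij_betw_same_card)
  then show ?thesis
    using assms by (auto simp: confs_def PiE_dflt_def exchange_def)
qed

text \<open>The binomial coefficient cancels the normalization, leaving a plain sum over
  configurations. Exchanging the two sites permutes these configurations, so both halves of the
  gradient contribute equally, whence the factor 2.\<close>

lemma canonical_expect_exchange_grad:
  assumes A: "finite A" and "x \<in> A" "x + unit_vec i \<in> A" and "N \<le> card A"
  shows "real (card A choose N) * canonical_expect A N (exchange_grad x i u) =
    2 * (\<Sum>U | U \<subseteq> A \<and> card U = N.
      (of_bool (x + unit_vec i \<in> U) - of_bool (x \<in> U)) * u (\<lambda>z. z \<in> U))"
proof -
  let ?y = "x + unit_vec i"
  let ?g = "\<lambda>\<eta>. (of_bool (\<eta> ?y) - of_bool (\<eta> x)) * u \<eta>"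
  have pos: "card A choose N > 0"
    \<comment> \<open>This is where \<open>N \<le> card A\<close> enters: \<open>pmf_of_set\<close>
      is the uniform law only on a nonempty set.\<close>
    using assms by simp
  then have ne: "confs A N \<noteq> {}"
    using A card_confs[of A N] by force
  have "(\<Sum>\<eta>\<in>confs A N. ?g (exchange \<eta> x ?y)) = (\<Sum>\<eta>\<in>confs A N. ?g \<eta>)"
    by (rule sum.reindex_bij_witness[where i = "\<lambda>\<eta>. exchange \<eta> x ?y" and
          j = "\<lambda>\<eta>. exchange \<eta> x ?y"])
      (use assms in \<open>auto simp: exchange_exchange exchange_in_confs\<close>)
  \<comment> \<open>The exchange reverses the sign of the difference of the two occupation
    values.\<close>
  moreover have "exchange_grad x i u \<eta> = ?g (exchange \<eta> x ?y) + ?g \<eta>" for \<eta>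
    by (auto simp: exchange_grad_def exchange_def)
  ultimately have "(\<Sum>\<eta>\<in>confs A N. exchange_grad x i u \<eta>) = 2 * (\<Sum>\<eta>\<in>confs A N. ?g \<eta>)"
    by (simp add: sum.distrib)
  then show ?thesis
    using pos ne A
    by (simp add: canonical_expect_def integral_pmf_of_set finite_confs card_confs sum_confs)
qed

section \<open>The identity at a single site, by comparing coefficients\<close>

lemma placement_expect_eq_canonical:
  assumes A: "finite A" "A \<noteq> {}" and x: "x \<in> A" "x + unit_vec i \<in> A" and y: "y \<in> A"
  shows "placement_expect A M (\<lambda>\<eta>. particle_diff i (lift u) \<eta> x) =
    (\<Sum>N=1..M + 1. if N \<le> card A then
       real (card A) * occupation_prob A M N y / (2 * real N)
         * canonical_expect A N (exchange_grad x i u) else 0)"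
proof -
  let ?c = "\<lambda>N. occupation_weight A M (N - 1) + occupation_weight A M N"
  let ?h = "\<lambda>U. (of_bool (x + unit_vec i \<in> U) - of_bool (x \<in> U)) * u (\<lambda>z. z \<in> U)"
  have summand: "(\<Sum>U | U \<subseteq> A \<and> card U = N. ?c (card U) * ?h U) =
    (if N \<le> card A then
       real (card A) * occupation_prob A M N y / (2 * real N)
         * canonical_expect A N (exchange_grad x i u) else 0)" if "1 \<le> N" for N
  proof (cases "N \<le> card A")
    case False
    then have "{U. U \<subseteq> A \<and> card U = N} = {}"
      using A card_mono by blast
    then show ?thesis using False by (simp only: sum.empty if_False)
  next
    case True
    \<comment> \<open>Absorption turns the number of N-element sets containing \<open>y\<close> into
      the number of all N-element sets. This produces the factor |A| / N; the remaining 1/2 comes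
      from the exchange gradient.\<close>
    have "N * (card A choose N) = card A * ((card A - 1) choose (N - 1))"
      using that times_binomial_minus1_eq[of N "card A"] by simp
    then have choose: "real N * real (card A choose N) = real (card A) * real ((card A - 1) choose (N - 1))"
      by (metis of_nat_mult)
    have "real (card A) * occupation_prob A M N y / (2 * real N) =
        real (card A choose N) * ?c N / 2"
    proof -
      have "real (card A) * occupation_prob A M N y =
          (real (card A) * real ((card A - 1) choose (N - 1))) * ?c N"
        using that by (simp add: occupation_prob_eq[OF A y])
      also have "\<dots> = real N * real (card A choose N) * ?c N"
        by (simp only: choose)
      finally show ?thesis
        using that by simp
    qed
    then have "real (card A) * occupation_prob A M N y / (2 * real N)
        * canonical_expect A N (exchange_grad x i u) =
        ?c N / 2 * (real (card A choose N) * canonical_expect A N (exchange_grad x i u))"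
      by (simp only: mult_ac times_divide_eq_left times_divide_eq_right)
    also have "\<dots> = ?c N * (\<Sum>U | U \<subseteq> A \<and> card U = N. ?h U)"
      by (simp only: canonical_expect_exchange_grad[OF A(1) x True])
    also have "\<dots> = (\<Sum>U | U \<subseteq> A \<and> card U = N. ?c (card U) * ?h U)"
      by (simp add: sum_distrib_left)
    finally show ?thesis
      using True by simp
  qed
  \<comment> \<open>The empty set contains neither site, so its difference of indicators is 0.
    Beyond size M + 1 both weights vanish, as M particles occupy at most M sites. Size M + 1 itself
    can contribute, through the weight at N - 1 = M.\<close>
  have zero: "?c (card U) * ?h U = 0" if "U \<subseteq> A" "card U \<notin> {1..M + 1}" for U
  proof (cases "card U = 0")
    case True
    then have "U = {}" using that finite_subset[OF _ A(1)] by auto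
    then show ?thesis by simp
  next
    case False
    then have "M < card U - 1"
      using that by auto
    then have "?c (card U) = 0"
      by (simp add: occupation_weight_def surjections_empty)
    then show ?thesis by simp
  qed
  have "placement_expect A M (\<lambda>\<eta>. particle_diff i (lift u) \<eta> x) =
      (\<Sum>U\<in>Pow A. ?c (card U) * ?h U)"
    by (rule placement_expect_particle_diff[OF A x])
  also have "\<dots> = (\<Sum>U\<in>{U \<in> Pow A. card U \<in> {1..M + 1}}. ?c (card U) * ?h U)"
    by (rule sum.mono_neutral_right) (use A zero in auto)
  also have "\<dots> = (\<Sum>N=1..M + 1. \<Sum>U | U \<in> {U \<in> Pow A. card U \<in> {1..M + 1}} \<and> card U = N.
      ?c (card U) * ?h U)"
    by (rule sum.group[symmetric]) (use A in auto)
  also have "\<dots> = (\<Sum>N=1..M + 1. \<Sum>U | U \<subseteq> A \<and> card U = N. ?c (card U) * ?h U)"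
    by (intro sum.cong refl) auto
  also have "\<dots> = (\<Sum>N=1..M + 1. if N \<le> card A then
       real (card A) * occupation_prob A M N y / (2 * real N)
         * canonical_expect A N (exchange_grad x i u) else 0)"
    by (intro sum.cong refl summand) simp
  finally show ?thesis .
qed

theorem proposition3p6:
  fixes M :: nat
    and \<Lambda> :: "(int ^ 'd::finite) set"
    and u :: "((int ^ 'd) \<Rightarrow> bool) \<Rightarrow> real"
  assumes "finite \<Lambda>" and "\<Lambda> \<noteq> {}"
    and "depends_only_on u (enlarge \<Lambda>)"
  shows "(\<forall>N. \<forall>y\<in>enlarge \<Lambda>. \<forall>y'\<in>enlarge \<Lambda>.
            occupation_prob (enlarge \<Lambda>) M N y = occupation_prob (enlarge \<Lambda>) M N y')
       \<and> (\<forall>N. \<forall>y\<in>enlarge \<Lambda>. card (enlarge \<Lambda>) < N \<longrightarrow> occupation_prob (enlarge \<Lambda>) M N y = 0)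
       \<and> (\<forall>y\<in>enlarge \<Lambda>. \<forall>i.
            (\<Sum>x\<in>\<Lambda>. placement_expect (enlarge \<Lambda>) M (\<lambda>\<eta>. particle_diff i (lift u) \<eta> x))
            = (\<Sum>N=1..M + 1.
                 if N \<le> card (enlarge \<Lambda>) then
                   real (card (enlarge \<Lambda>)) * occupation_prob (enlarge \<Lambda>) M N y / (2 * real N)
                     * (\<Sum>x\<in>\<Lambda>. canonical_expect (enlarge \<Lambda>) N (exchange_grad x i u))
                 else 0))"
proof -
  let ?A = "enlarge \<Lambda>"
  have A: "finite ?A" "?A \<noteq> {}"
    using assms by (auto simp: enlarge_def)
  have same: "occupation_prob ?A M N y = occupation_prob ?A M N y'"
    if "y \<in> ?A" "y' \<in> ?A" for N y y'
    using that A by (simp add: occupation_prob_eq)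
  have vanish: "occupation_prob ?A M N y = 0" if "y \<in> ?A" "card ?A < N" for N y
  proof -
    \<comment> \<open>Positivity keeps the inequality strict under truncated subtraction, so that
      the binomial coefficient vanishes.\<close>
    have "card ?A > 0"
      using A by (simp add: card_gt_0_iff)
    then have "card ?A - 1 < N - 1"
      using that by linarith
    then show ?thesis
      using that A by (simp add: occupation_prob_eq)
  qed
  have "(\<Sum>x\<in>\<Lambda>. placement_expect ?A M (\<lambda>\<eta>. particle_diff i (lift u) \<eta> x)) =
      (\<Sum>N=1..M + 1. if N \<le> card ?A then
         real (card ?A) * occupation_prob ?A M N y / (2 * real N)
           * (\<Sum>x\<in>\<Lambda>. canonical_expect ?A N (exchange_grad x i u)) else 0)"
    if "y \<in> ?A" for y i
  proof -
    have "(\<Sum>x\<in>\<Lambda>. placement_expect ?A M (\<lambda>\<eta>. particle_diff i (lift u) \<eta> x)) =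
      (\<Sum>x\<in>\<Lambda>. \<Sum>N=1..M + 1. if N \<le> card ?A then
         real (card ?A) * occupation_prob ?A M N y / (2 * real N)
           * canonical_expect ?A N (exchange_grad x i u) else 0)"
      using A that
      by (intro sum.cong refl placement_expect_eq_canonical) (auto simp: enlarge_def)
    also have "\<dots> = (\<Sum>N=1..M + 1. \<Sum>x\<in>\<Lambda>. if N \<le> card ?A then
         real (card ?A) * occupation_prob ?A M N y / (2 * real N)
           * canonical_expect ?A N (exchange_grad x i u) else 0)"
      by (rule sum.swap)
    also have "\<dots> = (\<Sum>N=1..M + 1. if N \<le> card ?A then
         real (card ?A) * occupation_prob ?A M N y / (2 * real N)
           * (\<Sum>x\<in>\<Lambda>. canonical_expect ?A N (exchange_grad x i u)) else 0)"
      by (intro sum.cong refl) (simp add: sum_distrib_left)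
    finally show ?thesis .
  qed
  with same vanish show ?thesis
    by blast
qed

end
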